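(* Let $G$ be a mixed graph and let $a,b\in V(G)$. Then there is zero transfer between vertices $a$ and $b$ if and only if $$\phi(G\setminus a,x)\,\phi(G\setminus b,x)=\phi(G\setminus ab,x)\,\phi(G,x)$$ as polynomials in $x$.
   Context: A mixed graph $G=(V,E,A)$ consists of a finite vertex set $V=V(G)$, a set $E$ of undirected edges and a set $A$ of directed edges (arcs), with no loops and at most one edge or arc between any two vertices. Its Hermitian adjacency matrix $H=(h_{uv})_{u,v\in V}$ is defined by $h_{uv}=1$ if $\{u,v\}\in E$, $h_{uv}=\mathrm{i}$ if $(u,v)\in A$, $h_{uv}=-\mathrm{i}$ if $(v,u)\in A$, and $h_{uv}=0$ otherwise, where $\mathrm{i}=\sqrt{-1}$. The transition matrix is $U(t)=\exp(-\mathrm{i}tH)$, $t\in\mathbb{R}$. There is zero transfer between vertices $a$ and $b$ if $U(t)_{a,b}=0$ for all $t\ge 0$ (this condition is symmetric in $a$ and $b$). For a mixed graph $G$, $\phi(G,x)$ denotes the characteristic polynomial of its Hermitian adjacency matrix (equal to $1$ for the graph with no vertices). $G\setminus a$, $G\setminus b$ and $G\setminus ab$ denote the subgraphs obtained from $G$ by deleting the vertices $a$, $b$, and $\{a,b\}$, respectively. *)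

theory Defs
  imports Complex_Main "Jordan_Normal_Form.Char_Poly"
begin

record 'v mixed_graph =
  verts :: "'v set"
  edges :: "'v set set"
  arcs :: "('v \<times> 'v) set"

locale mixed_graph =
  fixes G :: "'v mixed_graph"
  assumes finite_verts: "finite (verts G)"
    and edges_wf: "e \<in> edges G \<Longrightarrow> \<exists>u\<in>verts G. \<exists>v\<in>verts G. u \<noteq> v \<and> e = {u, v}"
    and arcs_wf: "(u, v) \<in> arcs G \<Longrightarrow> u \<in> verts G \<and> v \<in> verts G \<and> u \<noteq> v"
    and arc_not_edge: "(u, v) \<in> arcs G \<Longrightarrow> {u, v} \<notin> edges G"
    and arc_not_reversed: "(u, v) \<in> arcs G \<Longrightarrow> (v, u) \<notin> arcs G"

definition delete_verts :: "'v mixed_graph \<Rightarrow> 'v set \<Rightarrow> 'v mixed_graph" where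
  "delete_verts G S =
     \<lparr>verts = verts G - S,
      edges = {e \<in> edges G. e \<inter> S = {}},
      arcs = {(u, v) \<in> arcs G. u \<notin> S \<and> v \<notin> S}\<rparr>"

definition herm_adj :: "'v mixed_graph \<Rightarrow> 'v \<Rightarrow> 'v \<Rightarrow> complex" where
  "herm_adj G u v =
     (if {u, v} \<in> edges G then 1
      else if (u, v) \<in> arcs G then \<i>
      else if (v, u) \<in> arcs G then - \<i>
      else 0)"

text \<open>
  Matrices of the library are indexed by natural numbers, so the vertices are listed in
  an arbitrary but fixed order.  Another order conjugates the adjacency matrix by a
  permutation matrix, which affects neither the characteristic polynomial nor the entries
  of the transition matrix when these are addressed by vertices.
\<close>

definition vertex_list :: "'v mixed_graph \<Rightarrow> 'v list" where
  "vertex_list G = (SOME vs. distinct vs \<and> set vs = verts G)"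

definition vertex_index :: "'v mixed_graph \<Rightarrow> 'v \<Rightarrow> nat" where
  "vertex_index G v = (THE i. i < length (vertex_list G) \<and> vertex_list G ! i = v)"

definition herm_adj_mat :: "'v mixed_graph \<Rightarrow> complex mat" where
  "herm_adj_mat G =
     (let vs = vertex_list G; n = length vs
      in mat n n (\<lambda>(i, j). herm_adj G (vs ! i) (vs ! j)))"

definition graph_poly :: "'v mixed_graph \<Rightarrow> complex poly" where
  "graph_poly G = char_poly (herm_adj_mat G)"

text \<open>The exponential series of a square matrix, summed entrywise.\<close>

definition mat_exp :: "complex mat \<Rightarrow> complex mat" where
  "mat_exp M = mat (dim_row M) (dim_row M) (\<lambda>(i, j). \<Sum>k. (M ^\<^sub>m k) $$ (i, j) / fact k)"

definition transition_mat :: "'v mixed_graph \<Rightarrow> real \<Rightarrow> complex mat" where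
  "transition_mat G t = mat_exp ((- \<i> * complex_of_real t) \<cdot>\<^sub>m herm_adj_mat G)"

definition zero_transfer :: "'v mixed_graph \<Rightarrow> 'v \<Rightarrow> 'v \<Rightarrow> bool" where
  "zero_transfer G a b \<longleftrightarrow>
     (\<forall>t\<ge>0. transition_mat G t $$ (vertex_index G a, vertex_index G b) = 0)"

end

theory Submission
  imports Defs
begin

text \<open>
  Write \<open>C\<close> for the adjugate of \<open>xI - H\<close>.  Jacobi's identity turns the difference of the two
  products of characteristic polynomials into \<open>C\<^sub>a\<^sub>b C\<^sub>b\<^sub>a\<close>.  Since
  \<open>x\<^sup>k C = C H\<^sup>k + \<phi> (x\<^sup>k\<^sup>-\<^sup>1 + x\<^sup>k\<^sup>-\<^sup>2 H + \<dots> + H\<^sup>k\<^sup>-\<^sup>1)\<close> and the entries of \<open>C\<close> have smaller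
  degree than \<open>\<phi>\<close>, the entry \<open>C\<^sub>a\<^sub>b\<close> vanishes iff \<open>(H\<^sup>k)\<^sub>a\<^sub>b = 0\<close> for all \<open>k\<close>, a condition that is
  symmetric in \<open>a\<close> and \<open>b\<close> because \<open>H\<close> is Hermitian.  By uniqueness of power series it is
  also equivalent to \<open>exp(-itH)\<^sub>a\<^sub>b = 0\<close> for all \<open>t\<close>.  For \<open>a = b\<close> both sides of the equivalence
  fail: \<open>U(0)\<^sub>a\<^sub>a = 1\<close>, and the two products have different degrees.
\<close>

section \<open>Power series that vanish on the positive reals\<close>

text \<open>The sum tends to \<open>c 0\<close> at the origin and is zero along 1/(n+1), so
  \<open>c 0 = 0\<close>; dividing by \<open>t > 0\<close> then shifts the coefficients by
  one.\<close>

lemma powser_zero_on_pos_reals: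
  fixes c :: "nat \<Rightarrow> complex"
  assumes "\<And>x. summable (\<lambda>n. c n * x ^ n)"
    and "\<And>t::real. t > 0 \<Longrightarrow> (\<Sum>n. c n * of_real t ^ n) = 0"
  shows "c k = 0"
  using assms
proof (induction k arbitrary: c)
  have c0: "c 0 = 0" if sm: "\<And>x. summable (\<lambda>n. c n * x ^ n)"
    and z: "\<And>t::real. t > 0 \<Longrightarrow> (\<Sum>n. c n * of_real t ^ n) = 0" for c :: "nat \<Rightarrow> complex"
  proof -
    let ?f = "\<lambda>x. \<Sum>n. c n * x ^ n"
    let ?X = "\<lambda>n. complex_of_real (inverse (real (Suc n)))"
    have "(?f \<longlongrightarrow> c 0) (at 0)"
      by (rule powser_limit_0[of 1]) (simp_all add: sm summable_sums)
    moreover have "?X \<longlonglongrightarrow> of_real 0"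
      by (intro tendsto_of_real LIMSEQ_inverse_real_of_nat)
    then have "filterlim ?X (at 0) sequentially"
      unfolding filterlim_at by (auto simp: eventually_sequentially simp del: of_nat_Suc)
    ultimately have "(\<lambda>n. ?f (?X n)) \<longlonglongrightarrow> c 0"
      by (rule filterlim_compose)
    moreover have "?f (?X n) = 0" for n
      by (rule z) simp
    ultimately show "c 0 = 0"
      by (simp add: LIMSEQ_const_iff)
  qed
  {
    case 0
    then show ?case by (rule c0)
  next
    case (Suc k)
    have "c 0 = 0" using Suc.prems by (rule c0)
    show ?case
    proof (rule Suc.IH)
      show "summable (\<lambda>n. c (Suc n) * x ^ n)" for x
        using Suc.prems(1) by (rule powser_split_head)
      show "(\<Sum>n. c (Suc n) * of_real t ^ n) = 0" if "t > 0" for t :: real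
        using powser_split_head(1)[OF Suc.prems(1), of "of_real t"] Suc.prems(2)[OF that] \<open>c 0 = 0\<close> that
        by simp
    qed
  }
qed

section \<open>Jacobi's identity for the adjugate\<close>

text \<open>Indices 0 and 1 suffice, since \<open>a\<close> and \<open>b\<close> can be listed
  first. The matrix \<open>A\<close> will be xI - H over a polynomial ring, which is an integral
  domain.\<close>

lemma jacobi_adj_mat:
  fixes A :: "'a::idom mat"
  assumes A: "A \<in> carrier_mat (Suc (Suc m)) (Suc (Suc m))" and nz: "det A \<noteq> 0"
  shows "adj_mat A $$ (0,0) * adj_mat A $$ (1,1) - adj_mat A $$ (0,1) * adj_mat A $$ (1,0)
    = det A * det (mat_delete (mat_delete A 0 0) 0 0)"
proof -
  define n where "n = Suc (Suc m)"
  note A = A[folded n_def]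
  define C where "C = adj_mat A"
  have C: "C \<in> carrier_mat n n" and AC: "A * C = det A \<cdot>\<^sub>m 1\<^sub>m n"
    using adj_mat[OF A] by (auto simp: C_def)
  \<comment> \<open>\<open>M\<close> is the identity with its first two columns replaced by those of \<open>C\<close>; compare
    the determinants of \<open>A * M\<close> and cancel \<open>det A\<close>.\<close>
  define M1 where "M1 = mat 2 2 (\<lambda>(i,j). C $$ (i,j))"
  define M3 where "M3 = mat m 2 (\<lambda>(i,j). C $$ (i+2,j))"
  define M where "M = four_block_mat M1 (0\<^sub>m 2 m) M3 (1\<^sub>m m)"
  define D where "D = mat_delete (mat_delete A 0 0) 0 0"
  define A2 where "A2 = mat 2 m (\<lambda>(i,j). A $$ (i,j+2))"
  have Dm: "D \<in> carrier_mat m m" and Dij: "i < m \<Longrightarrow> j < m \<Longrightarrow> D $$ (i,j) = A $$ (i+2,j+2)" for i j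
    using A by (auto simp: D_def n_def mat_delete_def)
  have M: "M \<in> carrier_mat n n"
    by (auto simp: M_def n_def M1_def M3_def)
  have colM: "col M j = (if j < 2 then col C j else col (1\<^sub>m n) j)" if "j < n" for j
  proof (rule eq_vecI, goal_cases)
    case (1 i)
    \<comment> \<open>Row \<open>i\<close> of the lower block is row \<open>i - 2\<close> of
      \<open>M3\<close>, which reads row \<open>(i - 2) + 2\<close> of \<open>C\<close>; with
      truncated subtraction this is row \<open>i\<close> only for \<open>2 \<le> i\<close>.\<close>
    moreover have "Suc (Suc (i - 2)) = i" if "\<not> i < 2" using that by simp
    ultimately show ?case
      using that C by (auto simp: M_def M1_def M3_def n_def)
  qed (use C M in auto)
  \<comment> \<open>Columns 0 and 1 of \<open>A * M\<close> are those of \<open>A * C\<close>, a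
    multiple of the identity; the others are columns of \<open>A\<close>, cut into \<open>A2\<close>
    and \<open>D\<close>.\<close>
  have "A * M = four_block_mat (det A \<cdot>\<^sub>m 1\<^sub>m 2) A2 (0\<^sub>m m 2) D"
  proof (rule eq_matI, goal_cases)
    case (1 i j)
    then have ij: "i < n" "j < n" using Dm by (auto simp: n_def)
    have "(A * M) $$ (i,j) = row A i \<bullet> col M j"
      using A M ij by simp
    also have "\<dots> = (if j < 2 then (A * C) $$ (i,j) else (A * 1\<^sub>m n) $$ (i,j))"
      using A C ij by (simp add: colM)
    also have "\<dots> = (if j < 2 then (det A \<cdot>\<^sub>m 1\<^sub>m n) $$ (i,j) else A $$ (i,j))"
      using A by (simp add: AC)
    also have "\<dots> = four_block_mat (det A \<cdot>\<^sub>m 1\<^sub>m 2) A2 (0\<^sub>m m 2) D $$ (i,j)"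
    proof -
      have "Suc (Suc (k - 2)) = k" if "\<not> k < 2" for k :: nat using that by simp
      then show ?thesis
        using ij Dm Dij[of "i-2" "j-2"] by (auto simp: A2_def n_def)
    qed
    finally show ?case .
  qed (use A M Dm in \<open>auto simp: n_def\<close>)
  then have "det (A * M) = det A ^ 2 * det D"
    using det_four_block_mat_lower_left_zero[of "det A \<cdot>\<^sub>m 1\<^sub>m 2" 2 A2 m "0\<^sub>m m 2" D] Dm
    by (simp add: A2_def)
  moreover have "det M = det M1"
    using det_four_block_mat_upper_right_zero[of M1 2 "0\<^sub>m 2 m" m M3 "1\<^sub>m m"]
    by (simp add: M_def M1_def M3_def)
  moreover have "det M1 = C $$ (0,0) * C $$ (1,1) - C $$ (0,1) * C $$ (1,0)"
  proof -
    have M1: "M1 \<in> carrier_mat 2 2" by (simp add: M1_def)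
    have "det M1 = (\<Sum>j<2. M1 $$ (0,j) * cofactor M1 0 j)"
      by (rule laplace_expansion_row[OF M1]) simp
    moreover have "cofactor M1 0 0 = C $$ (1,1)" "cofactor M1 0 1 = - C $$ (1,0)"
      by (auto simp: cofactor_def mat_delete_def M1_def det_single numeral_2_eq_2)
    ultimately show ?thesis
      by (simp add: numeral_2_eq_2 M1_def)
  qed
  moreover have "det (A * M) = det A * det M"
    by (rule det_mult[OF A M])
  ultimately have "det A * (C $$ (0,0) * C $$ (1,1) - C $$ (0,1) * C $$ (1,0)) = det A * (det A * det D)"
    by (simp add: power2_eq_square mult.assoc)
  then show ?thesis
    using nz by (simp add: C_def D_def)
qed

section \<open>The adjugate of xI - H and the powers of H\<close>

text \<open>In \<open>main\<close> the sum has degree below \<open>n\<close>, so \<open>Q k\<close>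
  is the quotient of \<open>x^k * C_ij\<close> by the monic \<open>\<phi>\<close>. A zero dividend
  forces zero quotients, whose coefficients are entries of powers of \<open>H\<close>; conversely,
  zero quotients leave \<open>x^n * C_ij\<close> of degree below \<open>n\<close>.\<close>

lemma adj_char_poly_matrix_eq_0_iff:
  fixes H :: "'a::idom mat"
  assumes H: "H \<in> carrier_mat n n" and ij: "i < n" "j < n"
  shows "adj_mat (char_poly_matrix H) $$ (i,j) = 0 \<longleftrightarrow> (\<forall>k. (H ^\<^sub>m k) $$ (i,j) = 0)"
proof -
  define P where "P = char_poly_matrix H"
  define C where "C = adj_mat P"
  define \<phi> where "\<phi> = char_poly H"
  have P: "P \<in> carrier_mat n n" using H by (simp add: P_def)
  have C: "C \<in> carrier_mat n n" and CP: "C * P = \<phi> \<cdot>\<^sub>m 1\<^sub>m n"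
    using adj_mat[OF P] by (auto simp: C_def \<phi>_def char_poly_def P_def)
  have degC: "degree (C $$ (p,q)) < n" if "p < n" "q < n" for p q
  proof -
    have "degree (det (mat_delete P q p)) \<le> 1 * (n - 1)"
    proof (rule degree_det_le)
      show "mat_delete P q p \<in> carrier_mat (n-1) (n-1)"
        using P by (rule mat_delete_carrier)
      show "degree (mat_delete P q p $$ (r,s)) \<le> 1" if "r < n-1" "s < n-1" for r s
        using that H by (auto simp: mat_delete_def P_def char_poly_matrix_def intro!: degree_add_le)
    qed
    moreover have "C $$ (p,q) = (-1) ^ (q+p) * det (mat_delete P q p)"
      using that P by (simp add: C_def adj_mat_def cofactor_def)
    moreover have "degree ((-1) ^ k * r) = degree r" for k and r :: "'a poly"
      by (cases "even k") auto
    ultimately show ?thesis using that by auto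
  qed
  \<comment> \<open>The \<open>(i,l)\<close> entry of \<open>C * (xI - H) = \<phi> I\<close>, solved
    for \<open>x * C_il\<close>; \<open>pCons 0\<close> is multiplication by x.\<close>
  have xC: "pCons 0 (C $$ (i,l)) = (\<Sum>m<n. Polynomial.smult (H $$ (m,l)) (C $$ (i,m))) + (if i = l then \<phi> else 0)"
    if l: "l < n" for l
  proof -
    have "(if i = l then \<phi> else 0) = (C * P) $$ (i,l)"
      using ij l by (simp add: CP)
    also have "\<dots> = (\<Sum>m<n. C $$ (i,m) * P $$ (m,l))"
      using C P ij l by (simp add: scalar_prod_def lessThan_atLeast0)
    also have "\<dots> = (\<Sum>m<n. (if m = l then pCons 0 (C $$ (i,m)) else 0) - Polynomial.smult (H $$ (m,l)) (C $$ (i,m)))"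
      using H l by (intro sum.cong) (auto simp: P_def char_poly_matrix_def algebra_simps)
    also have "\<dots> = pCons 0 (C $$ (i,l)) - (\<Sum>m<n. Polynomial.smult (H $$ (m,l)) (C $$ (i,m)))"
      using l by (simp add: sum_subtractf)
    finally show ?thesis by simp
  qed
  \<comment> \<open>\<open>Q k\<close> is the \<open>(i,j)\<close> entry of \<open>x\<^sup>k\<^sup>-\<^sup>1 + x\<^sup>k\<^sup>-\<^sup>2 H + \<dots> + H\<^sup>k\<^sup>-\<^sup>1\<close>.\<close>
  define Q where "Q k = Poly (map (\<lambda>m. (H ^\<^sub>m m) $$ (i,j)) (rev [0..<k]))" for k
  have Q: "Q 0 = 0" "Q (Suc k) = pCons ((H ^\<^sub>m k) $$ (i,j)) (Q k)" for k
    by (simp_all add: Q_def)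
  have Hk: "H ^\<^sub>m k \<in> carrier_mat n n" for k
    using H by simp
  have main: "monom 1 k * C $$ (i,j) = (\<Sum>l<n. Polynomial.smult ((H ^\<^sub>m k) $$ (l,j)) (C $$ (i,l))) + \<phi> * Q k" for k
  proof (induction k)
    case 0
    have "(\<Sum>l<n. Polynomial.smult ((H ^\<^sub>m 0) $$ (l,j)) (C $$ (i,l))) = (\<Sum>l<n. if l = j then C $$ (i,l) else 0)"
      using H ij by (intro sum.cong) auto
    then show ?case using ij by (simp add: Q)
  next
    case (Suc k)
    \<comment> \<open>Substituting \<open>xC\<close> multiplies \<open>H ^\<^sub>m k\<close> by
      \<open>H\<close> from the left, whereas the recursion of \<open>^\<^sub>m\<close> multiplies
      from the right.\<close>
    have S: "H ^\<^sub>m Suc k = H * H ^\<^sub>m k"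
    proof (induction k)
      case (Suc k)
      then show ?case using H Hk[of k] by (simp add: assoc_mult_mat[of _ n n _ n _ n])
    qed (use H in auto)
    have "monom 1 (Suc k) * C $$ (i,j) = pCons 0 (monom 1 k * C $$ (i,j))"
      by (simp add: monom_Suc)
    also have "\<dots> = [:0,1:] * (\<Sum>l<n. Polynomial.smult ((H ^\<^sub>m k) $$ (l,j)) (C $$ (i,l))) + pCons 0 (\<phi> * Q k)"
      by (simp add: Suc.IH)
    also have "[:0,1:] * (\<Sum>l<n. Polynomial.smult ((H ^\<^sub>m k) $$ (l,j)) (C $$ (i,l)))
        = (\<Sum>l<n. Polynomial.smult ((H ^\<^sub>m k) $$ (l,j)) (pCons 0 (C $$ (i,l))))"
      by (simp add: sum_distrib_left)
    also have "\<dots> = (\<Sum>l<n. (\<Sum>m<n. Polynomial.smult (H $$ (m,l) * (H ^\<^sub>m k) $$ (l,j)) (C $$ (i,m)))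
        + (if i = l then Polynomial.smult ((H ^\<^sub>m k) $$ (l,j)) \<phi> else 0))"
      by (intro sum.cong) (simp_all only: xC lessThan_iff, simp_all add: smult_add_right smult_sum2 mult.commute)
    also have "\<dots> = (\<Sum>m<n. \<Sum>l<n. Polynomial.smult (H $$ (m,l) * (H ^\<^sub>m k) $$ (l,j)) (C $$ (i,m)))
        + Polynomial.smult ((H ^\<^sub>m k) $$ (i,j)) \<phi>"
      using ij by (subst sum.swap) (simp add: sum.distrib)
    also have "(\<Sum>m<n. \<Sum>l<n. Polynomial.smult (H $$ (m,l) * (H ^\<^sub>m k) $$ (l,j)) (C $$ (i,m)))
        = (\<Sum>m<n. Polynomial.smult ((H ^\<^sub>m Suc k) $$ (m,j)) (C $$ (i,m)))"
      unfolding S using H Hk[of k] ij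
      by (intro sum.cong) (simp_all add: smult_sum scalar_prod_def lessThan_atLeast0)
    finally show ?case by (simp add: Q algebra_simps)
  qed
  have degsum: "degree (\<Sum>l<n. Polynomial.smult (c l) (C $$ (i,l))) < n" for c
  proof -
    have "degree (\<Sum>l<n. Polynomial.smult (c l) (C $$ (i,l))) \<le> n - 1"
    proof (rule degree_sum_le)
      show "degree (Polynomial.smult (c l) (C $$ (i,l))) \<le> n - 1" if "l \<in> {..<n}" for l
        using degC[OF ij(1), of l] degree_smult_le[of "c l" "C $$ (i,l)"] that by simp
    qed simp
    then show ?thesis using ij by simp
  qed
  show ?thesis unfolding P_def[symmetric] C_def[symmetric]
  proof
    assume z: "C $$ (i,j) = 0"
    have "Q k = 0" for k
    proof (rule ccontr)
      assume "Q k \<noteq> 0"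
      moreover have "degree \<phi> = n" "\<phi> \<noteq> 0"
        using degree_monic_char_poly[OF H] by (auto simp: \<phi>_def)
      ultimately have "n \<le> degree (\<phi> * Q k)"
        by (simp add: degree_mult_eq)
      moreover have "\<phi> * Q k = - (\<Sum>l<n. Polynomial.smult ((H ^\<^sub>m k) $$ (l,j)) (C $$ (i,l)))"
        using main[of k] z by (simp add: eq_neg_iff_add_eq_0 add.commute)
      ultimately show False
        using degsum[of "\<lambda>l. (H ^\<^sub>m k) $$ (l,j)"] by simp
    qed
    then show "\<forall>k. (H ^\<^sub>m k) $$ (i,j) = 0"
      using Q(2) by (metis pCons_eq_0_iff)
  next
    assume z: "\<forall>k. (H ^\<^sub>m k) $$ (i,j) = 0"
    have "Q k = 0" for k
      by (induction k) (simp_all add: Q z)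
    then have "degree (monom 1 n * C $$ (i,j)) < n"
      using degsum by (simp add: main)
    then show "C $$ (i,j) = 0"
      using degree_mult_eq[of "monom 1 n :: 'a poly" "C $$ (i,j)"]
      by (auto simp: degree_monom_eq)
  qed
qed

section \<open>Matrices given by a function on pairs of vertices\<close>

text \<open>With the vertex list as a parameter, one weight function serves every order of the
  vertices and every vertex-deleted subgraph.\<close>

definition kernel_mat :: "'v list \<Rightarrow> ('v \<Rightarrow> 'v \<Rightarrow> 'a) \<Rightarrow> 'a mat" where
  "kernel_mat vs f = mat (length vs) (length vs) (\<lambda>(i, j). f (vs ! i) (vs ! j))"

lemma kernel_mat_carrier: "kernel_mat vs f \<in> carrier_mat (length vs) (length vs)"
  by (simp add: kernel_mat_def)

text \<open>Reordering the list applies the same permutation to rows and to columns, and the two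
  signs cancel.\<close>

lemma det_kernel_mat_cong:
  assumes "distinct xs" "distinct ys" "set xs = set ys"
  shows "det (kernel_mat xs f) = det (kernel_mat ys f)"
proof -
  define n where "n = length ys"
  have "mset xs = mset ys"
    using assms by (simp add: set_eq_iff_mset_eq_distinct)
  then obtain p where p: "p permutes {..<n}" and xs: "permute_list p ys = xs"
    unfolding n_def by (rule mset_eq_permutation)
  have len: "length xs = n" using xs by (auto simp: n_def)
  have nth: "xs ! i = ys ! p i" if "i < n" for i
    using permute_list_nth[of p ys i] p that xs by (simp add: n_def)
  have pn: "p i < n" if "i < n" for i
    using permutes_in_image[OF p] that by simp
  have p': "p permutes {0..<n}" using p by (simp add: lessThan_atLeast0)
  define K where "K = kernel_mat ys f"
  define B where "B = mat n n (\<lambda>(i, j). K $$ (i, p j))"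
  have K: "K \<in> carrier_mat n n" by (simp add: K_def n_def kernel_mat_carrier)
  have B: "B \<in> carrier_mat n n" by (simp add: B_def)
  have "kernel_mat xs f = mat n n (\<lambda>(i, j). B $$ (p i, j))"
    by (rule eq_matI) (auto simp: kernel_mat_def B_def K_def len nth pn n_def[symmetric])
  then have "det (kernel_mat xs f) = signof p * det B"
    using det_permute_rows[OF B p'] by simp
  \<comment> \<open>The column permutation is treated as a row permutation of the transpose.\<close>
  moreover have "transpose_mat B = mat n n (\<lambda>(i, j). transpose_mat K $$ (p i, j))"
    using K by (intro eq_matI) (auto simp: B_def pn)
  then have "det (transpose_mat B) = signof p * det (transpose_mat K)"
    using det_permute_rows[OF _ p', of "transpose_mat K"] K by simp
  then have "det B = signof p * det K"
    using det_transpose[OF B] det_transpose[OF K] by simp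
  moreover have "signof p * (signof p * x) = x" for x :: 'b
    by (simp add: sign_def)
  ultimately show ?thesis by (simp add: K_def)
qed

text \<open>The entries of xI - H addressed by vertices, so that xI - H is itself a
  \<open>kernel_mat\<close>. The test \<open>u = v\<close> singles out the diagonal only when the
  list is distinct.\<close>

definition char_kernel :: "('v \<Rightarrow> 'v \<Rightarrow> 'a::comm_ring_1) \<Rightarrow> 'v \<Rightarrow> 'v \<Rightarrow> 'a poly" where
  "char_kernel f u v = (if u = v then [:0, 1:] else 0) + [:- f u v:]"

lemma char_poly_matrix_kernel_mat:
  assumes "distinct vs"
  shows "char_poly_matrix (kernel_mat vs f) = kernel_mat vs (char_kernel f)"
  using assms
  by (intro eq_matI) (auto simp: char_poly_matrix_def kernel_mat_def char_kernel_def nth_eq_iff_index_eq)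

lemma mat_delete_kernel_mat_0: "mat_delete (kernel_mat (x # xs) f) 0 0 = kernel_mat xs f"
  by (rule eq_matI) (auto simp: mat_delete_def kernel_mat_def)

lemma mat_delete_kernel_mat_1: "mat_delete (kernel_mat (x # y # xs) f) 1 1 = kernel_mat (x # xs) f"
  by (rule eq_matI) (auto simp: mat_delete_def kernel_mat_def nth_Cons split: nat.split)

section \<open>Powers of H as sums over walks\<close>

text \<open>For \<open>u\<close>, \<open>v\<close> in \<open>V\<close> this is the
  \<open>(u,v)\<close> entry of the k-th matrix power, free of any vertex order. It links the
  arbitrary \<open>vertex_list\<close> of the transition matrix with a list that starts with
  \<open>a\<close>, \<open>b\<close>.\<close>

primrec walk_sum :: "'v set \<Rightarrow> ('v \<Rightarrow> 'v \<Rightarrow> 'a::comm_ring_1) \<Rightarrow> nat \<Rightarrow> 'v \<Rightarrow> 'v \<Rightarrow> 'a" where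
  "walk_sum V f 0 = (\<lambda>u v. if u = v then 1 else 0)"
| "walk_sum V f (Suc k) = (\<lambda>u v. \<Sum>w\<in>V. walk_sum V f k u w * f w v)"

lemma walk_sum_Suc_left:
  assumes "finite V" "u \<in> V" "v \<in> V"
  shows "walk_sum V f (Suc k) u v = (\<Sum>w\<in>V. f u w * walk_sum V f k w v)"
  using assms(3)
proof (induction k arbitrary: v)
  case 0
  have "(\<Sum>w\<in>V. (if u = w then 1 else 0) * f w v) = (\<Sum>w\<in>V. if u = w then f w v else 0)"
    "(\<Sum>w\<in>V. f u w * (if w = v then 1 else 0)) = (\<Sum>w\<in>V. if w = v then f u w else 0)"
    by (auto intro: sum.cong)
  then show ?case using assms 0 by simp
next
  case (Suc k)
  have "walk_sum V f (Suc (Suc k)) u v = (\<Sum>w\<in>V. walk_sum V f (Suc k) u w * f w v)"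
    by simp
  also have "\<dots> = (\<Sum>w\<in>V. (\<Sum>z\<in>V. f u z * walk_sum V f k z w) * f w v)"
    using Suc.IH by (intro sum.cong) auto
  also have "\<dots> = (\<Sum>z\<in>V. f u z * (\<Sum>w\<in>V. walk_sum V f k z w * f w v))"
    by (simp add: sum_distrib_left sum_distrib_right mult.assoc) (rule sum.swap)
  finally show ?case by simp
qed

text \<open>Conjugation reverses walks, turning the last step into the first;
  \<open>walk_sum_Suc_left\<close> splits off that first step.\<close>

lemma walk_sum_hermitian:
  fixes f :: "'v \<Rightarrow> 'v \<Rightarrow> complex"
  assumes "finite V" and herm: "\<And>u v. f v u = cnj (f u v)" and "u \<in> V" "v \<in> V"
  shows "walk_sum V f k v u = cnj (walk_sum V f k u v)"
  using assms(3,4)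
proof (induction k arbitrary: u v)
  case (Suc k)
  have "walk_sum V f (Suc k) v u = (\<Sum>w\<in>V. cnj (walk_sum V f k w v) * cnj (f u w))"
    unfolding walk_sum.simps
    by (intro sum.cong refl arg_cong2[where f = times] Suc.IH Suc.prems herm)
  also have "\<dots> = cnj (\<Sum>w\<in>V. f u w * walk_sum V f k w v)"
    by (simp add: mult.commute)
  also have "\<dots> = cnj (walk_sum V f (Suc k) u v)"
    using Suc.prems assms(1) by (simp only: walk_sum_Suc_left)
  finally show ?case .
qed auto

text \<open>At most \<open>card V ^ k\<close> walks contribute, each with modulus at most 1. The
  bound makes the exponential series converge.\<close>

lemma norm_walk_sum_le:
  fixes f :: "'v \<Rightarrow> 'v \<Rightarrow> complex"
  assumes "\<And>u v. norm (f u v) \<le> 1"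
  shows "norm (walk_sum V f k u v) \<le> real (card V) ^ k"
proof (induction k arbitrary: v)
  case (Suc k)
  have "norm (walk_sum V f (Suc k) u v) \<le> (\<Sum>w\<in>V. norm (walk_sum V f k u w) * norm (f w v))"
    using norm_sum[of "\<lambda>w. walk_sum V f k u w * f w v" V] by (simp add: norm_mult)
  also have "\<dots> \<le> (\<Sum>w\<in>V. real (card V) ^ k * 1)"
    by (intro sum_mono mult_mono Suc.IH assms) auto
  finally show ?case by simp
qed simp

text \<open>The scalar is \<open>- \<i> * t\<close> in the exponential and 1 in the adjugate
  criterion.\<close>

lemma smult_kernel_mat_pow:
  assumes "distinct vs" "i < length vs" "j < length vs"
  shows "((c \<cdot>\<^sub>m kernel_mat vs f) ^\<^sub>m k) $$ (i, j) = c ^ k * walk_sum (set vs) f k (vs ! i) (vs ! j)"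
  using assms(3)
proof (induction k arbitrary: j)
  case 0
  then show ?case using assms by (simp add: kernel_mat_def nth_eq_iff_index_eq)
next
  case (Suc k)
  let ?M = "c \<cdot>\<^sub>m kernel_mat vs f"
  have M: "?M \<in> carrier_mat (length vs) (length vs)"
    by (simp add: kernel_mat_carrier)
  then have Mk: "?M ^\<^sub>m k \<in> carrier_mat (length vs) (length vs)"
    by simp
  have "(?M ^\<^sub>m Suc k) $$ (i, j) = (\<Sum>l<length vs. (?M ^\<^sub>m k) $$ (i, l) * ?M $$ (l, j))"
    using carrier_matD[OF M] carrier_matD[OF Mk] Suc.prems assms(2)
    by (simp add: scalar_prod_def lessThan_atLeast0 del: pow_mat_dim index_smult_mat)
  also have "\<dots> = (\<Sum>l<length vs. c ^ Suc k * (walk_sum (set vs) f k (vs ! i) (vs ! l) * f (vs ! l) (vs ! j)))"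
    using Suc by (intro sum.cong) (auto simp: kernel_mat_def)
  also have "\<dots> = (\<Sum>w\<in>set vs. c ^ Suc k * (walk_sum (set vs) f k (vs ! i) w * f w (vs ! j)))"
    using assms(1) by (intro sum.reindex_bij_betw bij_betw_nth) auto
  finally show ?case by (simp add: sum_distrib_left)
qed

lemma adj_char_kernel_mat_eq_0_iff:
  fixes f :: "'v \<Rightarrow> 'v \<Rightarrow> 'a::idom"
  assumes "distinct vs" "i < length vs" "j < length vs"
  shows "adj_mat (kernel_mat vs (char_kernel f)) $$ (i, j) = 0
    \<longleftrightarrow> (\<forall>k. walk_sum (set vs) f k (vs ! i) (vs ! j) = 0)"
proof -
  have "1 \<cdot>\<^sub>m kernel_mat vs f = kernel_mat vs f"
    by (rule eq_matI) auto
  then show ?thesis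
    using adj_char_poly_matrix_eq_0_iff[OF kernel_mat_carrier assms(2,3), of f]
      smult_kernel_mat_pow[OF assms, of 1 f]
    by (simp add: char_poly_matrix_kernel_mat[OF assms(1)])
qed

section \<open>Characteristic polynomials of vertex-deleted subgraphs\<close>

lemma herm_adj_delete_verts:
  assumes "u \<notin> S" "v \<notin> S"
  shows "herm_adj (delete_verts G S) u v = herm_adj G u v"
  using assms by (simp add: herm_adj_def delete_verts_def)

lemma norm_herm_adj_le: "norm (herm_adj G u v) \<le> 1"
  by (simp add: herm_adj_def)

lemma vertex_list:
  assumes "finite (verts G)"
  shows "distinct (vertex_list G)" "set (vertex_list G) = verts G"
proof -
  have "distinct (vertex_list G) \<and> set (vertex_list G) = verts G"
    unfolding vertex_list_def
    by (rule someI_ex) (use finite_distinct_list[OF assms] in auto)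
  then show "distinct (vertex_list G)" "set (vertex_list G) = verts G" by auto
qed

lemma vertex_index:
  assumes "finite (verts G)" "v \<in> verts G"
  shows "vertex_index G v < length (vertex_list G)" "vertex_list G ! vertex_index G v = v"
proof -
  have "\<exists>!i. i < length (vertex_list G) \<and> vertex_list G ! i = v"
    using vertex_list[OF assms(1)] assms(2) by (metis distinct_Ex1)
  from theI'[OF this] show "vertex_index G v < length (vertex_list G)" "vertex_list G ! vertex_index G v = v"
    by (auto simp: vertex_index_def)
qed

lemma herm_adj_mat_eq: "herm_adj_mat G = kernel_mat (vertex_list G) (herm_adj G)"
  by (simp add: herm_adj_mat_def kernel_mat_def Let_def)

text \<open>Deletion keeps the weights between the remaining vertices, and the determinant ignores
  their order, so \<open>xs\<close> can be chosen freely. \<open>S = {}\<close> gives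
  \<open>G\<close> itself.\<close>

lemma graph_poly_delete_verts:
  assumes "finite (verts G)" "distinct xs" "set xs = verts G - S"
  shows "graph_poly (delete_verts G S) = det (kernel_mat xs (char_kernel (herm_adj G)))"
proof -
  let ?D = "delete_verts G S"
  have fin: "finite (verts ?D)" and V: "verts ?D = set xs"
    using assms by (auto simp: delete_verts_def)
  note vl = vertex_list[OF fin]
  have "herm_adj_mat ?D = kernel_mat (vertex_list ?D) (herm_adj G)"
  proof -
    have "vertex_list ?D ! i \<notin> S" if "i < length (vertex_list ?D)" for i
      using nth_mem[OF that] vl V assms by auto
    then show ?thesis
      unfolding herm_adj_mat_eq by (intro eq_matI) (auto simp: kernel_mat_def herm_adj_delete_verts)
  qed
  then have "graph_poly ?D = det (kernel_mat (vertex_list ?D) (char_kernel (herm_adj G)))"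
    using vl by (simp add: graph_poly_def char_poly_def char_poly_matrix_kernel_mat)
  also have "\<dots> = det (kernel_mat xs (char_kernel (herm_adj G)))"
    using vl V assms by (intro det_kernel_mat_cong) auto
  finally show ?thesis .
qed

lemma delete_verts_empty: "delete_verts G {} = G"
  by (simp add: delete_verts_def)

lemma degree_graph_poly:
  assumes "finite (verts G)"
  shows "degree (graph_poly G) = card (verts G)" "graph_poly G \<noteq> 0"
proof -
  have "length (vertex_list G) = card (verts G)"
    using vertex_list[OF assms] distinct_card by metis
  then have "degree (graph_poly G) = card (verts G) \<and> coeff (graph_poly G) (card (verts G)) = 1"
    using degree_monic_char_poly[OF kernel_mat_carrier[of "vertex_list G" "herm_adj G"]]
    by (simp add: graph_poly_def herm_adj_mat_eq)
  then show "degree (graph_poly G) = card (verts G)" "graph_poly G \<noteq> 0" by auto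
qed

section \<open>Zero transfer in terms of walks\<close>

context mixed_graph
begin

lemma herm_adj_hermitian: "herm_adj G v u = cnj (herm_adj G u v)"
proof -
  \<comment> \<open>Opposite arcs would give \<open>\<i>\<close> in both directions, which is not
    Hermitian.\<close>
  have "\<not> ((u, v) \<in> arcs G \<and> (v, u) \<in> arcs G)"
    using arc_not_reversed by blast
  then show ?thesis
    unfolding herm_adj_def insert_commute[of v u] by auto
qed

text \<open>The entry of U(t) is an everywhere convergent power series in t whose k-th coefficient
  is a nonzero multiple of the walk sum of length k.\<close>

lemma zero_transfer_iff_walk_sum:
  assumes "a \<in> verts G" "b \<in> verts G"
  shows "zero_transfer G a b \<longleftrightarrow> (\<forall>k. walk_sum (verts G) (herm_adj G) k a b = 0)"
proof -
  let ?W = "\<lambda>k. walk_sum (verts G) (herm_adj G) k a b"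
  define c where "c k = (- \<i>) ^ k * ?W k / fact k" for k
  note vl = vertex_list[OF finite_verts]
  note ia = vertex_index[OF finite_verts assms(1)] and ib = vertex_index[OF finite_verts assms(2)]
  have entry: "transition_mat G t $$ (vertex_index G a, vertex_index G b) = (\<Sum>k. c k * of_real t ^ k)" for t
  proof -
    let ?M = "(- \<i> * of_real t) \<cdot>\<^sub>m kernel_mat (vertex_list G) (herm_adj G)"
    have "(?M ^\<^sub>m k) $$ (vertex_index G a, vertex_index G b) / fact k = c k * of_real t ^ k" for k
      by (simp only: smult_kernel_mat_pow[OF vl(1) ia(1) ib(1)] ia(2) ib(2) vl(2) c_def power_mult_distrib)
        (simp add: ac_simps)
    moreover have "dim_row ?M = length (vertex_list G)"
      by (simp add: kernel_mat_def)
    ultimately show ?thesis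
      unfolding transition_mat_def mat_exp_def herm_adj_mat_eq
      by (simp only: index_mat(1) ia(1) ib(1) split_conv)
  qed
  have sm: "summable (\<lambda>k. c k * x ^ k)" for x
  proof (rule summable_comparison_test')
    show "summable (\<lambda>k. (real (card (verts G)) * norm x) ^ k /\<^sub>R fact k)"
      by (rule summable_exp_generic)
    show "norm (c k * x ^ k) \<le> (real (card (verts G)) * norm x) ^ k /\<^sub>R fact k" for k
    proof -
      have "norm (?W k) * norm x ^ k \<le> real (card (verts G)) ^ k * norm x ^ k"
        by (intro mult_right_mono norm_walk_sum_le norm_herm_adj_le) simp
      then have "norm (?W k) * norm x ^ k / fact k \<le> (real (card (verts G)) * norm x) ^ k / fact k"
        by (intro divide_right_mono) (simp_all add: power_mult_distrib)
      moreover have "norm (c k * x ^ k) = norm (?W k) * norm x ^ k / fact k"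
        by (simp add: c_def norm_mult norm_divide norm_power)
      ultimately show ?thesis
        by (simp only: real_scaleR_def divide_inverse_commute)
    qed
  qed
  show ?thesis
  proof
    assume "zero_transfer G a b"
    then have "c k = 0" for k
      using powser_zero_on_pos_reals[of c, OF sm] by (simp add: zero_transfer_def entry)
    then show "\<forall>k. ?W k = 0" by (simp add: c_def)
  qed (simp add: zero_transfer_def entry c_def)
qed

end

section \<open>The polynomial identity for equal and for distinct vertices\<close>

theorem proposition3p2:
  fixes G :: "'v mixed_graph" and a b :: 'v
  assumes "mixed_graph G" and "a \<in> verts G" and "b \<in> verts G"
  shows "zero_transfer G a b \<longleftrightarrow>
    graph_poly (delete_verts G {a}) * graph_poly (delete_verts G {b}) =
    graph_poly (delete_verts G {a, b}) * graph_poly G"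
proof -
  interpret mixed_graph G by fact
  note zt = zero_transfer_iff_walk_sum[OF assms(2,3)]
  show ?thesis
  proof (cases "a = b")
    case True
    \<comment> \<open>The walk of length 0 from \<open>a\<close> to itself has weight 1.\<close>
    have "\<not> zero_transfer G a b"
      using True unfolding zt by (auto intro!: exI[of _ 0])
    \<comment> \<open>Here \<open>{a, b} = {a}\<close>, so cancelling the nonzero common factor
      would leave an equality of polynomials of different degrees.\<close>
    moreover have "graph_poly (delete_verts G {a}) \<noteq> graph_poly G"
    proof -
      have "card (verts (delete_verts G {a})) < card (verts G)"
        using finite_verts assms(2) by (intro psubset_card_mono) (auto simp: delete_verts_def)
      then show ?thesis
        using degree_graph_poly(1)[of G] degree_graph_poly(1)[of "delete_verts G {a}"] finite_verts
        by (auto simp: delete_verts_def)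
    qed
    moreover have "graph_poly (delete_verts G {a}) \<noteq> 0"
      using finite_verts by (intro degree_graph_poly) (simp add: delete_verts_def)
    ultimately show ?thesis using True by simp
  next
    case False
    obtain xs where xs: "set xs = verts G - {a, b}" "distinct xs"
      using finite_distinct_list[of "verts G - {a, b}"] finite_verts by auto
    \<comment> \<open>This order puts \<open>a\<close> and \<open>b\<close> at the positions 0 and 1
      of \<open>jacobi_adj_mat\<close>.\<close>
    define vs where "vs = a # b # xs"
    have vs: "distinct vs" "set vs = verts G"
      using xs False assms by (auto simp: vs_def)
    define P where "P = kernel_mat vs (char_kernel (herm_adj G))"
    have P: "P \<in> carrier_mat (Suc (Suc (length xs))) (Suc (Suc (length xs)))"
      using kernel_mat_carrier[of vs] by (simp add: P_def vs_def)
    have \<phi>: "graph_poly G = det P"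
      using graph_poly_delete_verts[of G vs "{}"] vs finite_verts by (simp add: P_def delete_verts_empty)
    \<comment> \<open>Diagonal cofactors carry the sign +1, and removing row and column 0 removes
      \<open>a\<close> from the list.\<close>
    have \<phi>a: "graph_poly (delete_verts G {a}) = adj_mat P $$ (0, 0)"
      using graph_poly_delete_verts[of G "b # xs" "{a}"] xs False assms finite_verts P
      by (auto simp: adj_mat_def cofactor_def P_def vs_def mat_delete_kernel_mat_0)
    have \<phi>b: "graph_poly (delete_verts G {b}) = adj_mat P $$ (1, 1)"
      using graph_poly_delete_verts[of G "a # xs" "{b}"] xs False assms finite_verts P
      by (auto simp: adj_mat_def cofactor_def P_def vs_def mat_delete_kernel_mat_1[simplified])
    have \<phi>ab: "graph_poly (delete_verts G {a, b}) = det (mat_delete (mat_delete P 0 0) 0 0)"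
      using graph_poly_delete_verts[of G xs "{a, b}"] xs finite_verts
      by (simp add: P_def vs_def mat_delete_kernel_mat_0)
    have "det P \<noteq> 0"
      using degree_graph_poly(2)[OF finite_verts] \<phi> by simp
    from jacobi_adj_mat[OF P this]
    have "graph_poly (delete_verts G {a}) * graph_poly (delete_verts G {b})
        - adj_mat P $$ (0, 1) * adj_mat P $$ (1, 0)
      = graph_poly (delete_verts G {a, b}) * graph_poly G"
      unfolding \<phi> \<phi>a \<phi>b \<phi>ab by (simp add: mult.commute)
    \<comment> \<open>The subtracted product is zero iff one of its factors is, complex polynomials
      being an integral domain.\<close>
    then have "graph_poly (delete_verts G {a}) * graph_poly (delete_verts G {b})
        = graph_poly (delete_verts G {a, b}) * graph_poly G
      \<longleftrightarrow> adj_mat P $$ (0, 1) = 0 \<or> adj_mat P $$ (1, 0) = 0"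
      by (auto simp: algebra_simps)
    moreover have "adj_mat P $$ (0, 1) = 0 \<longleftrightarrow> zero_transfer G a b"
      using adj_char_kernel_mat_eq_0_iff[OF vs(1), of 0 1 "herm_adj G"] vs(2)
      by (simp add: P_def zt) (simp add: vs_def)
    \<comment> \<open>The walk sums from \<open>b\<close> to \<open>a\<close> are the conjugates of
      those from \<open>a\<close> to \<open>b\<close>.\<close>
    moreover have "adj_mat P $$ (1, 0) = 0 \<longleftrightarrow> zero_transfer G a b"
      using adj_char_kernel_mat_eq_0_iff[OF vs(1), of 1 0 "herm_adj G"] vs(2)
        walk_sum_hermitian[OF finite_verts herm_adj_hermitian assms(2,3)]
      by (simp add: P_def zt) (simp add: vs_def)
    ultimately show ?thesis by blast
  qed
qed

end
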